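(* Let $F$ be a nice forest. Then, for every set $W$ of $|E(F)|$ distinct strictly positive integers, there exists an edge-injective neighbour-sum-distinguishing $W$-edge-weighting of $F$. In particular, $\chi^{e,1}_\Sigma(F)=|E(F)|$.
   Context: All graphs are finite, simple, undirected and loopless. A graph is nice if none of its connected components is isomorphic to $K_2$. For a set $W$ of weights, a $W$-edge-weighting of a graph $G$ is a map $w:E(G)\to W$; a $k$-edge-weighting is a $\{1,\dots,k\}$-edge-weighting. For an edge-weighting $w$ and a vertex $v$, $\sigma_w(v)=\sum_{u\in N(v)} w(vu)$. The weighting $w$ is neighbour-sum-distinguishing if $\sigma_w(u)\neq\sigma_w(v)$ for every edge $uv$, and edge-injective if no two distinct edges receive the same weight. For a nice graph $G$, $\chi^{e,1}_\Sigma(G)$ denotes the smallest $k$ such that $G$ admits an edge-injective neighbour-sum-distinguishing $k$-edge-weighting. *)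

theory Defs
  imports Main "HOL-Library.FuncSet"
begin

text \<open>
  A graph is given by its vertex set and its set of edges, an edge being the two-element set of
  its ends. (In the digraphs of the AFP entry Graph\_Theory an undirected edge is a pair of
  opposite arcs, which already forms a cycle in the sense of that entry, so its notion of forest
  does not apply here.)
\<close>

definition simple_graph :: "'a set \<Rightarrow> 'a set set \<Rightarrow> bool" where
  "simple_graph V E \<longleftrightarrow> finite V \<and> (\<forall>e\<in>E. e \<subseteq> V \<and> card e = 2)"

definition neighbours :: "'a set set \<Rightarrow> 'a \<Rightarrow> 'a set" where
  "neighbours E v = {u. {v, u} \<in> E}"

definition is_cycle :: "'a set set \<Rightarrow> 'a list \<Rightarrow> bool" where
  "is_cycle E vs \<longleftrightarrow> 3 \<le> length vs \<and> distinct vs \<and>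
     (\<forall>i<length vs. {vs ! i, vs ! (Suc i mod length vs)} \<in> E)"

definition forest :: "'a set \<Rightarrow> 'a set set \<Rightarrow> bool" where
  "forest V E \<longleftrightarrow> simple_graph V E \<and> (\<nexists>vs. is_cycle E vs)"

definition component_of :: "'a set set \<Rightarrow> 'a \<Rightarrow> 'a set" where
  "component_of E v = {u. (v, u) \<in> {(x, y). {x, y} \<in> E}\<^sup>*}"

definition components :: "'a set \<Rightarrow> 'a set set \<Rightarrow> 'a set set" where
  "components V E = component_of E ` V"

definition induced_edges :: "'a set set \<Rightarrow> 'a set \<Rightarrow> 'a set set" where
  "induced_edges E C = {e \<in> E. e \<subseteq> C}"

definition graph_iso ::
    "'a set \<Rightarrow> 'a set set \<Rightarrow> 'b set \<Rightarrow> 'b set set \<Rightarrow> bool" where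
  "graph_iso V E V' E' \<longleftrightarrow>
     (\<exists>f. bij_betw f V V' \<and> (\<forall>u\<in>V. \<forall>v\<in>V. {u, v} \<in> E \<longleftrightarrow> {f u, f v} \<in> E'))"

definition complete_edges :: "'a set \<Rightarrow> 'a set set" where
  "complete_edges V = {e. e \<subseteq> V \<and> card e = 2}"

definition nice :: "'a set \<Rightarrow> 'a set set \<Rightarrow> bool" where
  "nice V E \<longleftrightarrow>
     (\<forall>C\<in>components V E.
        \<not> graph_iso C (induced_edges E C) {..<2::nat} (complete_edges {..<2::nat}))"

text \<open>Edge-weightings are total functions; only their values on the edge set matter.\<close>

definition edge_weighting :: "'a set set \<Rightarrow> int set \<Rightarrow> ('a set \<Rightarrow> int) \<Rightarrow> bool" where
  "edge_weighting E W w \<longleftrightarrow> w \<in> E \<rightarrow> W"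

definition weighted_degree :: "'a set set \<Rightarrow> ('a set \<Rightarrow> int) \<Rightarrow> 'a \<Rightarrow> int" where
  "weighted_degree E w v = (\<Sum>u\<in>neighbours E v. w {v, u})"

definition neighbour_sum_distinguishing :: "'a set set \<Rightarrow> ('a set \<Rightarrow> int) \<Rightarrow> bool" where
  "neighbour_sum_distinguishing E w \<longleftrightarrow>
     (\<forall>u v. {u, v} \<in> E \<longrightarrow> weighted_degree E w u \<noteq> weighted_degree E w v)"

definition edge_injective :: "'a set set \<Rightarrow> ('a set \<Rightarrow> int) \<Rightarrow> bool" where
  "edge_injective E w \<longleftrightarrow> inj_on w E"

definition chi_e1_Sigma :: "'a set set \<Rightarrow> nat" where
  "chi_e1_Sigma E =
     (LEAST k. \<exists>w. edge_weighting E {1..int k} w \<and> edge_injective E w \<and>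
                   neighbour_sum_distinguishing E w)"

end

theory Submission
  imports Defs
begin

text \<open>
  Since weights are positive, a pendant edge whose other end has degree at least two never causes
  a conflict. If some edge has two ends of degree at least two, then the forest formed by such
  edges has a leaf \<open>v\<close>; let \<open>p\<close> be its neighbour there, and let \<open>k \<ge> 1\<close> be the number of pendant
  edges of \<open>F\<close> at \<open>v\<close>. Delete these pendant edges and apply induction with \<open>k\<close> of the weights
  put aside. Putting them back affects only the edge \<open>vp\<close>, where the sum of the \<open>k\<close> reserved weights
  has to differ from the sum of the weights of the other \<open>deg p - 1\<close> edges at \<open>p\<close>. Reserving the
  \<open>k\<close> largest weights if \<open>deg p - 1 \<le> k\<close> and the \<open>k\<close> smallest ones otherwise achieves this.
\<close>

section \<open>Neighbourhoods, leaves and pendant edges\<close>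

lemma neighbours_iff: "u \<in> neighbours E v \<longleftrightarrow> {v, u} \<in> E"
  by (simp add: neighbours_def)

lemma finite_Union_edges:
  assumes "finite E" and "\<forall>e\<in>E. card e = 2"
  shows "finite (\<Union>E)"
proof (rule finite_Union[OF assms(1)])
  show "finite e" if "e \<in> E" for e
    using assms(2) that by (intro card_ge_0_finite) simp
qed

lemma finite_neighbours:
  assumes "finite E" and "\<forall>e\<in>E. card e = 2"
  shows "finite (neighbours E v)"
proof -
  have "finite (\<Union>E)"
    using assms by (rule finite_Union_edges)
  moreover have "neighbours E v \<subseteq> \<Union>E"
    by (auto simp: neighbours_def)
  ultimately show ?thesis
    by (rule rev_finite_subset)
qed

lemma edge_ends_distinct:
  assumes "\<forall>e\<in>E. card e = 2" and "{x, y} \<in> E"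
  shows "x \<noteq> y"
  using assms by fastforce

text \<open>An endpoint of a longest path is a leaf: any further neighbour would either extend the
  path or close a cycle.\<close>

lemma acyclic_imp_leaf:
  assumes "finite E" and two: "\<forall>e\<in>E. card e = 2" and "E \<noteq> {}" and acyc: "\<nexists>vs. is_cycle E vs"
  obtains v p where "neighbours E v = {p}"
proof -
  \<comment> \<open>Requiring two vertices puts every vertex of a path on an edge, which bounds the
    lengths of paths, and makes \<open>vs ! 1\<close> available as the neighbour sought.\<close>
  define path where
    "path vs \<longleftrightarrow> 2 \<le> length vs \<and> distinct vs \<and> (\<forall>i. Suc i < length vs \<longrightarrow> {vs ! i, vs ! Suc i} \<in> E)"
    for vs
  obtain a b where ab: "{a, b} \<in> E"
    using assms by (metis card_2_iff ex_in_conv)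
  then have "path [a, b]"
    using edge_ends_distinct[OF two] by (auto simp: path_def less_Suc_eq)
  moreover have "length vs < Suc (card (\<Union>E))" if "path vs" for vs
  proof -
    have "x \<in> \<Union>E" if "x \<in> set vs" for x
    proof -
      from that obtain i where i: "i < length vs" "x = vs ! i"
        by (metis in_set_conv_nth)
      show ?thesis
      proof (cases "Suc i < length vs")
        case True
        then have "{vs ! i, vs ! Suc i} \<in> E"
          using \<open>path vs\<close> by (simp add: path_def)
        then show ?thesis
          using i by blast
      next
        case False
        then obtain j where "i = Suc j"
          using \<open>path vs\<close> i by (cases i) (auto simp: path_def)
        then have "{vs ! j, vs ! i} \<in> E"
          using \<open>path vs\<close> i by (simp add: path_def)
        then show ?thesis
          using i by blast
      qed
    qed
    moreover have "finite (\<Union>E)"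
      using assms(1,2) by (rule finite_Union_edges)
    ultimately have "card (set vs) \<le> card (\<Union>E)"
      by (intro card_mono) auto
    then show ?thesis
      using that by (simp add: path_def distinct_card)
  qed
  ultimately obtain vs where vs: "path vs" and longest: "\<And>us. path us \<Longrightarrow> length us \<le> length vs"
    using ex_has_greatest_nat[of path "[a, b]" length "Suc (card (\<Union>E))"] by (metis less_imp_le)
  have len: "2 \<le> length vs" and dist: "distinct vs"
    and steps: "\<And>i. Suc i < length vs \<Longrightarrow> {vs ! i, vs ! Suc i} \<in> E"
    using vs by (auto simp: path_def)
  have "y = vs ! 1" if y: "{vs ! 0, y} \<in> E" for y
  proof (cases "y \<in> set vs")
    case False
    have "path (y # vs)"
      unfolding path_def
    proof (intro conjI allI impI)
      fix i
      assume "Suc i < length (y # vs)"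
      then show "{(y # vs) ! i, (y # vs) ! Suc i} \<in> E"
        using steps y by (cases i) (auto simp: insert_commute)
    qed (use len dist False in auto)
    then show ?thesis
      using longest by fastforce
  next
    case True
    then obtain j where j: "j < length vs" "y = vs ! j"
      by (metis in_set_conv_nth)
    show ?thesis
    proof (rule ccontr)
      assume "y \<noteq> vs ! 1"
      moreover have "y \<noteq> vs ! 0"
        using edge_ends_distinct[OF two y] by simp
      ultimately have "2 \<le> j"
        using j by (metis One_nat_def less_2_cases not_less)
      \<comment> \<open>The edge from \<open>y\<close> back to \<open>vs ! 0\<close> closes the
        initial segment ending in \<open>y\<close>; \<open>2 \<le> j\<close> provides the three
        vertices that a cycle needs.\<close>
      have "is_cycle E (take (Suc j) vs)"
        unfolding is_cycle_def
      proof (intro conjI allI impI)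
        fix i
        assume "i < length (take (Suc j) vs)"
        then have "i \<le> j"
          by simp
        then show "{take (Suc j) vs ! i, take (Suc j) vs ! (Suc i mod length (take (Suc j) vs))} \<in> E"
          using j y steps[of i] by (cases "i = j") (auto simp: insert_commute min_absorb2)
      qed (use \<open>2 \<le> j\<close> j dist in auto)
      then show False
        using acyc by blast
    qed
  qed
  moreover have "{vs ! 0, vs ! 1} \<in> E"
    using steps[of 0] len by simp
  ultimately have "neighbours E (vs ! 0) = {vs ! 1}"
    unfolding neighbours_def by blast
  then show ?thesis
    by (rule that)
qed

text \<open>The sum at the leaf \<open>a\<close> is the weight of \<open>ab\<close> alone, while the
  sum at \<open>b\<close> contains that weight and the positive weight of \<open>bc\<close>.\<close>

lemma weighted_degree_pendant_less:
  assumes "finite E" and two: "\<forall>e\<in>E. card e = 2" and pos: "\<forall>e\<in>E. 0 < w e"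
    and a: "neighbours E a = {b}" and bc: "{b, c} \<in> E" "c \<noteq> a"
  shows "weighted_degree E w a < weighted_degree E w b"
proof -
  have ab: "{b, a} \<in> E"
    using a by (auto simp: neighbours_def insert_commute)
  have "w {b, a} < w {b, a} + w {b, c}"
    using pos bc by simp
  also have "\<dots> = (\<Sum>u\<in>{a, c}. w {b, u})"
    using bc by simp
  also have "\<dots> \<le> weighted_degree E w b"
    unfolding weighted_degree_def
  proof (rule sum_mono2)
    show "finite (neighbours E b)"
      using assms by (intro finite_neighbours)
    show "{a, c} \<subseteq> neighbours E b"
      using ab bc by (simp add: neighbours_def)
    show "0 \<le> w {b, u}" if "u \<in> neighbours E b - {a, c}" for u
      using that pos by (auto simp: neighbours_def intro: less_imp_le)
  qed
  finally show ?thesis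
    by (simp add: weighted_degree_def a insert_commute)
qed

section \<open>Extremal subsets and comparison of sums\<close>

lemma ex_smallest_subset:
  fixes W :: "'b::linorder set"
  assumes "finite W" and "k \<le> card W"
  shows "\<exists>A\<subseteq>W. card A = k \<and> (\<forall>x\<in>A. \<forall>y\<in>W - A. x < y)"
  using assms(2)
proof (induction k)
  case 0
  then show ?case
    by (intro exI[of _ "{}"]) auto
next
  case (Suc k)
  then obtain A where A: "A \<subseteq> W" "card A = k" "\<forall>x\<in>A. \<forall>y\<in>W - A. x < y"
    by auto
  let ?m = "Min (W - A)"
  have fin: "finite A" "finite (W - A)"
    using A assms(1) finite_subset by auto
  have "W - A \<noteq> {}"
    using A Suc.prems fin by (metis Diff_eq_empty_iff not_less_eq_eq order_refl subset_antisym)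
  then have m: "?m \<in> W - A"
    using fin by (intro Min_in)
  moreover have "?m < y" if "y \<in> W - A" "y \<noteq> ?m" for y
    using Min_le[OF fin(2) that(1)] that(2) by simp
  ultimately show ?case
    using A fin by (intro exI[of _ "insert ?m A"]) auto
qed

lemma ex_largest_subset:
  fixes W :: "'b::linorder set"
  assumes "finite W" and "k \<le> card W"
  shows "\<exists>A\<subseteq>W. card A = k \<and> (\<forall>x\<in>A. \<forall>y\<in>W - A. y < x)"
proof -
  \<comment> \<open>The complement of the \<open>card W - k\<close> smallest elements consists of
    the \<open>k\<close> largest.\<close>
  obtain B where B: "B \<subseteq> W" "card B = card W - k" "\<forall>x\<in>B. \<forall>y\<in>W - B. x < y"
    using ex_smallest_subset[OF assms(1), of "card W - k"] by auto
  have "card (W - B) = k"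
    using B assms by (simp add: card_Diff_subset finite_subset)
  then show ?thesis
    using B by (intro exI[of _ "W - B"]) auto
qed

text \<open>Let m be the minimum of \<open>A\<close>. Integrality bounds the elements of
  \<open>B\<close> by m - 1. As m - 1 \<ge> 0, passing from \<open>card B\<close> to
  \<open>card A\<close> summands does not lower the bound, and as \<open>A\<close> is nonempty,
  replacing m - 1 by m makes it strictly larger.\<close>

lemma sum_less_of_card_le:
  fixes A B :: "int set"
  assumes "finite A" "A \<noteq> {}" "card B \<le> card A"
    and pos: "\<forall>x\<in>A. 0 < x" and less: "\<forall>x\<in>A. \<forall>y\<in>B. y < x"
  shows "\<Sum>B < \<Sum>A"
proof -
  let ?m = "Min A"
  have m: "?m \<in> A"
    using assms by (intro Min_in)
  have "\<Sum>B \<le> int (card B) * (?m - 1)"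
    using less m by (intro sum_bounded_above) fastforce
  also have "\<dots> \<le> int (card A) * (?m - 1)"
    using assms m by (intro mult_right_mono) fastforce+
  also have "\<dots> < int (card A) * ?m"
    using assms(1,2) by (simp add: card_gt_0_iff mult_strict_left_mono del: Min_gr_iff)
  also have "\<dots> \<le> \<Sum>A"
    using assms by (intro sum_bounded_below) simp
  finally show ?thesis .
qed

section \<open>Inductive construction of the weighting\<close>

lemma ex_bij_distinguishing_weighting:
  fixes E :: "'a set set" and W :: "int set"
  assumes "finite E" "\<forall>e\<in>E. card e = 2" "\<nexists>vs. is_cycle E vs"
    and "\<And>x y. {x, y} \<in> E \<Longrightarrow> \<exists>z. z \<noteq> x \<and> z \<noteq> y \<and> ({x, z} \<in> E \<or> {y, z} \<in> E)"
    and "finite W" "card W = card E" "\<forall>x\<in>W. 0 < x"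
  shows "\<exists>w. bij_betw w E W \<and> neighbour_sum_distinguishing E w"
  using assms
\<comment> \<open>The condition that every edge meets another one replaces niceness: it speaks of no
  components, so it is easy to check again after a deletion. \<open>W\<close> varies because the
  recursive call has fewer weights.\<close>
proof (induction "card E" arbitrary: E W rule: less_induct)
  case less
  note fin = less.prems(1) and two = less.prems(2) and acyc = less.prems(3)
    and noK2 = less.prems(4) and W = less.prems(5-7)
  note finN = finite_neighbours[OF fin two]
  \<comment> \<open>An end of an edge has some neighbour, so a neighbourhood that is not a singleton
    means degree at least two here.\<close>
  define E2 where "E2 = {e \<in> E. \<forall>x\<in>e. \<forall>y. neighbours E x \<noteq> {y}}"
  show ?case
  proof (cases "E2 = {}")
    case True
    \<comment> \<open>Every edge now has an end of degree one, so any bijection will do.\<close>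
    obtain w where w: "bij_betw w E W"
      using finite_same_card_bij[OF fin W(1)] W(2) by auto
    have pos: "\<forall>e\<in>E. 0 < w e"
      using w W(3) by (auto simp: bij_betw_def)
    have pendant: "weighted_degree E w a < weighted_degree E w b"
      if ab: "{a, b} \<in> E" and a: "neighbours E a = {b}" for a b
    proof -
      obtain c where c: "c \<noteq> a" "c \<noteq> b" "{a, c} \<in> E \<or> {b, c} \<in> E"
        using noK2[OF ab] by blast
      then have "{b, c} \<in> E"
        using a by (auto simp: neighbours_def)
      then show ?thesis
        using weighted_degree_pendant_less[OF fin two pos a] c by blast
    qed
    have "weighted_degree E w a \<noteq> weighted_degree E w b" if ab: "{a, b} \<in> E" for a b
    proof -
      have "b \<in> neighbours E a" "a \<in> neighbours E b"
        using ab by (auto simp: neighbours_def insert_commute)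
      moreover have "{a, b} \<notin> E2"
        using True by blast
      ultimately have "neighbours E a = {b} \<or> neighbours E b = {a}"
        using ab by (auto simp: E2_def)
      then show ?thesis
        using pendant[of a b] pendant[of b a] ab by (auto simp: insert_commute)
    qed
    then show ?thesis
      using w by (auto simp: neighbour_sum_distinguishing_def)
  next
    case False
    have "\<nexists>vs. is_cycle E2 vs"
      using acyc by (auto simp: is_cycle_def E2_def)
    then obtain v p where vp2: "neighbours E2 v = {p}"
      using acyclic_imp_leaf[of E2] False fin two by (auto simp: E2_def)
    then have "{v, p} \<in> E2"
      by (auto simp: neighbours_def)
    then have vp: "{v, p} \<in> E" and v: "\<And>y. neighbours E v \<noteq> {y}" and p: "\<And>y. neighbours E p \<noteq> {y}"
      by (auto simp: E2_def)
    have "v \<noteq> p"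
      using edge_ends_distinct[OF two vp] .
    \<comment> \<open>\<open>L\<close> will turn out to consist of leaves, so the number k of
      pendant edges at \<open>v\<close> is \<open>card L\<close>, and \<open>card R\<close> is deg p
      - 1.\<close>
    define L where "L = neighbours E v - {p}"
    define R where "R = neighbours E p - {v}"
    define D where "D = (\<lambda>l. {v, l}) ` L"
    define E' where "E' = E - D"
    have finL: "finite L" and finR: "finite R"
      by (simp_all add: L_def R_def finN)
    have Nv: "neighbours E v = insert p L" and "p \<notin> L"
      using vp by (auto simp: L_def neighbours_def)
    have Np: "neighbours E p = insert v R" and "v \<notin> R"
      using vp by (auto simp: R_def neighbours_def insert_commute)
    have "L \<noteq> {}" "R \<noteq> {}"
      using v Nv p Np by auto
    have "v \<notin> L"
      using edge_ends_distinct[OF two, of v v] by (auto simp: L_def neighbours_def)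
    \<comment> \<open>The edge \<open>vl\<close> is not in \<open>E2\<close> although
      \<open>v\<close> has degree at least two, so \<open>l\<close> must be the end with a single
      neighbour.\<close>
    have NL: "neighbours E l = {v}" if "l \<in> L" for l
    proof -
      have "l \<notin> neighbours E2 v"
        using that vp2 by (simp add: L_def)
      moreover have vl: "{v, l} \<in> E"
        using that by (simp add: L_def neighbours_def)
      ultimately have "\<exists>y. neighbours E l = {y}"
        using v by (auto simp: E2_def neighbours_iff)
      moreover have "v \<in> neighbours E l"
        using vl by (simp add: neighbours_def insert_commute)
      ultimately show ?thesis
        by auto
    qed
    have at_L: "b = v" if "l \<in> L" "{l, b} \<in> E \<or> {b, l} \<in> E" for l b
      using that NL[OF that(1)] neighbours_iff[of b E l] by (auto simp: insert_commute)
    have edges_v: "b = p \<or> b \<in> L" if "{v, b} \<in> E \<or> {b, v} \<in> E" for b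
      using that Nv neighbours_iff[of b E v] by (auto simp: insert_commute)
    have inj: "inj_on (\<lambda>l. {v, l}) L"
      by (auto simp: inj_on_def doubleton_eq_iff)
    have "D \<subseteq> E" "D \<noteq> {}" "finite D" and cardD: "card D = card L"
      using \<open>L \<noteq> {}\<close> finL inj by (auto simp: D_def L_def neighbours_def card_image)
    \<comment> \<open>All edges at \<open>L\<close> lead to \<open>v\<close>, so deleting
      \<open>D\<close> amounts to isolating the vertices of \<open>L\<close>.\<close>
    have E'_iff: "{a, b} \<in> E' \<longleftrightarrow> {a, b} \<in> E \<and> a \<notin> L \<and> b \<notin> L" for a b
    proof -
      have "{a, b} \<in> D \<longleftrightarrow> a \<in> L \<or> b \<in> L" if "{a, b} \<in> E"
      proof -
        have "b = v" if "a \<in> L"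
          using at_L[OF that] \<open>{a, b} \<in> E\<close> by blast
        moreover have "a = v" if "b \<in> L"
          using at_L[OF that] \<open>{a, b} \<in> E\<close> by blast
        ultimately show ?thesis
          by (auto simp: D_def doubleton_eq_iff)
      qed
      then show ?thesis
        by (auto simp: E'_def)
    qed
    have RL: "q \<notin> L" if "q \<in> R" for q
      using that at_L[of q p] \<open>v \<noteq> p\<close> by (auto simp: R_def neighbours_iff)
    have cardE': "card E' = card E - card L"
      using \<open>D \<subseteq> E\<close> \<open>finite D\<close> cardD by (simp add: E'_def card_Diff_subset)
    have LE: "card L \<le> card E"
      using cardD card_mono[OF fin \<open>D \<subseteq> E\<close>] by simp
    \<comment> \<open>The reserved weights lie entirely above or entirely below the others, chosen
      so that the side with the larger weights also has at least as many summands, as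
      \<open>sum_less_of_card_le\<close> requires.\<close>
    obtain W1 where W1: "W1 \<subseteq> W" "card W1 = card L"
      and split: "if card R \<le> card L then \<forall>x\<in>W1. \<forall>y\<in>W - W1. y < x
                  else \<forall>x\<in>W1. \<forall>y\<in>W - W1. x < y"
    proof (cases "card R \<le> card L")
      case True
      with that show thesis
        using ex_largest_subset[of W "card L"] W LE by auto
    next
      case False
      with that show thesis
        using ex_smallest_subset[of W "card L"] W LE by auto
    qed
    have finW1: "finite W1"
      using W1 W(1) finite_subset by auto
    have "\<exists>w. bij_betw w E' (W - W1) \<and> neighbour_sum_distinguishing E' w"
    proof (rule less.hyps)
      show "card E' < card E"
        using \<open>D \<subseteq> E\<close> \<open>D \<noteq> {}\<close> fin by (intro psubset_card_mono) (auto simp: E'_def)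
      show "\<nexists>vs. is_cycle E' vs"
        using acyc by (auto simp: is_cycle_def E'_def)
      show "card (W - W1) = card E'"
        using W W1 cardE' finW1 by (simp add: card_Diff_subset)
      show "\<exists>z. z \<noteq> x \<and> z \<noteq> y \<and> ({x, z} \<in> E' \<or> {y, z} \<in> E')" if xy: "{x, y} \<in> E'" for x y
      proof -
        have xy': "{x, y} \<in> E" "x \<notin> L" "y \<notin> L"
          using xy by (auto simp: E'_iff)
        \<comment> \<open>Only an edge at \<open>v\<close> can lose adjacent edges, and the one such
          edge left is \<open>vp\<close>. For it \<open>pq\<close> serves as the adjacent edge,
          which survives because \<open>R\<close> and \<open>L\<close> are disjoint.\<close>
        obtain q where q: "q \<in> R"
          using \<open>R \<noteq> {}\<close> by blast
        then have pq: "{p, q} \<in> E'" "q \<noteq> v"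
          using RL \<open>p \<notin> L\<close> by (auto simp: E'_iff R_def neighbours_def)
        then have "q \<noteq> p"
          using edge_ends_distinct[OF two] by (auto simp: E'_iff)
        obtain z where z: "z \<noteq> x" "z \<noteq> y" "{x, z} \<in> E \<or> {y, z} \<in> E"
          using noK2[OF xy'(1)] by blast
        show ?thesis
        proof (cases "z \<in> L")
          case True
          then have "x = v \<or> y = v"
            using z at_L[OF True] by blast
          then have "{x, y} = {v, p}"
            using xy' edges_v by blast
          then show ?thesis
            using pq \<open>q \<noteq> p\<close> by (auto simp: doubleton_eq_iff)
        next
          case False
          then show ?thesis
            using z xy' E'_iff by blast
        qed
      qed
    qed (use fin two W in \<open>auto simp: E'_def\<close>)
    then obtain w' where w': "bij_betw w' E' (W - W1)" and nsd: "neighbour_sum_distinguishing E' w'"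
      by blast
    obtain g where g: "bij_betw g D W1"
      using finite_same_card_bij[OF \<open>finite D\<close> finW1] W1 cardD by auto
    define w where "w e = (if e \<in> D then g e else w' e)" for e
    have wD: "bij_betw w D W1"
      using g by (simp add: w_def cong: bij_betw_cong)
    have wE': "bij_betw w E' (W - W1)"
      using w' by (subst bij_betw_cong[of E' w w']) (auto simp: w_def E'_def)
    have "bij_betw w (D \<union> E') (W1 \<union> (W - W1))"
      using wD wE' by (rule bij_betw_combine) auto
    then have w: "bij_betw w E W"
      using \<open>D \<subseteq> E\<close> W1 by (simp add: E'_def Un_absorb1)
    have pos: "\<forall>e\<in>E. 0 < w e"
      using w W(3) by (auto simp: bij_betw_def)
    \<comment> \<open>A deleted edge has one end in \<open>L\<close> and the other is
      \<open>v\<close>, so all other vertices keep the sums of the recursive weighting.\<close>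
    have unchanged: "weighted_degree E w a = weighted_degree E' w' a" if "a \<notin> L" "a \<noteq> v" for a
    proof -
      have "neighbours E' a = neighbours E a"
        using that at_L unfolding neighbours_def E'_iff by blast
      moreover have "w {a, u} = w' {a, u}" if "u \<in> neighbours E' a" for u
        using that by (auto simp: w_def E'_def neighbours_def)
      ultimately show ?thesis
        by (simp add: weighted_degree_def)
    qed
    have pendant: "weighted_degree E w l < weighted_degree E w v" if "l \<in> L" for l
      using weighted_degree_pendant_less[OF fin two pos NL[OF that] vp] that \<open>p \<notin> L\<close> by blast
    \<comment> \<open>The weight of \<open>vp\<close> enters both sums and cancels, leaving the
      reserved weights \<open>W1\<close> against the weights \<open>B\<close> of the other edges at
      \<open>p\<close>.\<close>
    have main: "weighted_degree E w v \<noteq> weighted_degree E w p"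
    proof -
      have "(\<Sum>l\<in>L. w {v, l}) = sum w D"
        unfolding D_def using inj by (simp add: sum.reindex)
      also have "\<dots> = \<Sum>W1"
        using sum.reindex_bij_betw[OF wD, of "\<lambda>x. x"] by simp
      finally have deg_v: "weighted_degree E w v = w {v, p} + \<Sum>W1"
        using finL \<open>p \<notin> L\<close> by (simp add: weighted_degree_def Nv)
      define B where "B = (\<lambda>q. w {p, q}) ` R"
      have RE': "{p, q} \<in> E'" if "q \<in> R" for q
        using that RL \<open>p \<notin> L\<close> by (auto simp: E'_iff R_def neighbours_def)
      \<comment> \<open>Injectivity turns the sum over the edges from \<open>p\<close> to
        \<open>R\<close> into the sum of a set of exactly \<open>card R\<close> integers.\<close>
      have injR: "inj_on (\<lambda>q. w {p, q}) R"
      proof (rule inj_onI)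
        fix q q'
        assume "q \<in> R" "q' \<in> R" "w {p, q} = w {p, q'}"
        then have "{p, q} = {p, q'}"
          using wE' RE' by (metis bij_betw_def inj_onD)
        then show "q = q'"
          by (auto simp: doubleton_eq_iff)
      qed
      have deg_p: "weighted_degree E w p = w {v, p} + \<Sum>B"
        using finR \<open>v \<notin> R\<close> injR
        by (simp add: weighted_degree_def Np B_def sum.reindex insert_commute)
      have cardB: "card B = card R"
        using injR by (simp add: B_def card_image)
      have BW: "B \<subseteq> W - W1"
        using wE' RE' by (auto simp: B_def bij_betw_def)
      have "\<Sum>W1 \<noteq> \<Sum>B"
      proof (cases "card R \<le> card L")
        case True
        have "\<Sum>B < \<Sum>W1"
        proof (rule sum_less_of_card_le)
          show "W1 \<noteq> {}"
            using W1 finL \<open>L \<noteq> {}\<close> by auto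
        qed (use True split BW W1 W finW1 cardB in auto)
        then show ?thesis
          by simp
      next
        case False
        have "\<Sum>W1 < \<Sum>B"
        proof (rule sum_less_of_card_le)
          show "finite B" "B \<noteq> {}"
            using finR \<open>R \<noteq> {}\<close> by (auto simp: B_def)
        qed (use False split BW W1 W cardB in auto)
        then show ?thesis
          by simp
      qed
      then show ?thesis
        using deg_v deg_p by simp
    qed
    have at_v: "weighted_degree E w v \<noteq> weighted_degree E w b" if "{v, b} \<in> E" for b
      using edges_v[of b] that main pendant[of b] by auto
    \<comment> \<open>An edge avoiding \<open>v\<close> also avoids \<open>L\<close>, so both of its
      ends keep their recursive sums.\<close>
    have "weighted_degree E w a \<noteq> weighted_degree E w b" if ab: "{a, b} \<in> E" for a b
    proof (cases "a = v \<or> b = v")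
      case True
      then show ?thesis
        using at_v[of a] at_v[of b] ab by (metis insert_commute)
    next
      case False
      then have "a \<notin> L" "b \<notin> L"
        using ab at_L by blast+
      moreover from this have "weighted_degree E' w' a \<noteq> weighted_degree E' w' b"
        using nsd ab by (simp add: neighbour_sum_distinguishing_def E'_iff)
      ultimately show ?thesis
        using False unchanged by simp
    qed
    then show ?thesis
      using w by (auto simp: neighbour_sum_distinguishing_def)
  qed
qed

section \<open>From niceness to the edge condition, and the result for forests\<close>

lemma nice_imp_adjacent_edge:
  assumes two: "\<forall>e\<in>E. e \<subseteq> V \<and> card e = 2" and "nice V E" and xy: "{x, y} \<in> E"
  shows "\<exists>z. z \<noteq> x \<and> z \<noteq> y \<and> ({x, z} \<in> E \<or> {y, z} \<in> E)"
\<comment> \<open>If no other edge met \<open>xy\<close>, its two ends would form a component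
  isomorphic to K2.\<close>
proof (rule ccontr)
  assume none: "\<not> ?thesis"
  have "x \<noteq> y" and "x \<in> V"
    using two xy by fastforce+
  have no_loop: "{u, u} \<notin> E" for u
    using two by fastforce
  have nbr: "u \<in> {x, y}" if "t \<in> {x, y}" "{t, u} \<in> E" for t u
    using none that no_loop by auto
  have "component_of E x = {x, y}"
  proof
    \<comment> \<open>By \<open>nbr\<close> the set \<open>{x, y}\<close> is closed under adjacency,
      so no walk from \<open>x\<close> leaves it.\<close>
    have "u \<in> {x, y}" if "(x, u) \<in> {(s, t). {s, t} \<in> E}\<^sup>*" for u
      using that by (induction rule: rtrancl_induct) (use nbr in blast)+
    then show "component_of E x \<subseteq> {x, y}"
      by (auto simp: component_of_def)
    show "{x, y} \<subseteq> component_of E x"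
      using xy by (auto simp: component_of_def)
  qed
  then have C: "{x, y} \<in> components V E"
    using \<open>x \<in> V\<close> by (auto simp: components_def)
  define f where "f u = (if u = x then 0 else 1 :: nat)" for u
  have "{..<2::nat} = {0, 1}"
    by auto
  then have "bij_betw f {x, y} {..<2}"
    using \<open>x \<noteq> y\<close> by (auto simp: bij_betw_def inj_on_def f_def)
  \<comment> \<open>For \<open>u = t\<close> both sides fail: \<open>E\<close> has no loops, and a
    singleton does not have two elements.\<close>
  moreover have "{u, t} \<in> induced_edges E {x, y} \<longleftrightarrow> {f u, f t} \<in> complete_edges {..<2}"
    if "u \<in> {x, y}" "t \<in> {x, y}" for u t
    using that xy no_loop \<open>x \<noteq> y\<close>
    by (auto simp: induced_edges_def complete_edges_def f_def insert_commute)
  ultimately have "graph_iso {x, y} (induced_edges E {x, y}) {..<2::nat} (complete_edges {..<2})"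
    unfolding graph_iso_def by blast
  then show False
    using assms(2) C by (auto simp: nice_def)
qed

theorem theorem3p3:
  fixes V :: "'a set" and E :: "'a set set"
  assumes "forest V E" and "nice V E"
  shows "(\<forall>W :: int set. finite W \<and> card W = card E \<and> (\<forall>x\<in>W. 0 < x) \<longrightarrow>
            (\<exists>w. edge_weighting E W w \<and> edge_injective E w \<and>
                 neighbour_sum_distinguishing E w))
         \<and> chi_e1_Sigma E = card E"
proof -
  have "finite V" and two: "\<forall>e\<in>E. e \<subseteq> V \<and> card e = 2" and acyc: "\<nexists>vs. is_cycle E vs"
    using assms(1) by (auto simp: forest_def simple_graph_def)
  then have fin: "finite E"
    by (meson Pow_iff finite_Pow_iff finite_subset subsetI)
  have weighting: "\<exists>w. edge_weighting E W w \<and> edge_injective E w \<and> neighbour_sum_distinguishing E w"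
    if "finite W" "card W = card E" "\<forall>x\<in>W. 0 < x" for W :: "int set"
  proof -
    have "\<exists>w. bij_betw w E W \<and> neighbour_sum_distinguishing E w"
      using fin two acyc that nice_imp_adjacent_edge[OF two assms(2)]
      by (intro ex_bij_distinguishing_weighting) auto
    then show ?thesis
      by (auto simp: edge_weighting_def edge_injective_def bij_betw_def)
  qed
  moreover have "chi_e1_Sigma E = card E"
    unfolding chi_e1_Sigma_def
  \<comment> \<open>The choice \<open>W = {1..card E}\<close> attains the value, and injectivity
    rules out having fewer weights than edges.\<close>
  proof (rule Least_equality)
    show "\<exists>w. edge_weighting E {1..int (card E)} w \<and> edge_injective E w \<and>
              neighbour_sum_distinguishing E w"
      by (rule weighting) auto
    show "card E \<le> k"
      if ex: "\<exists>w. edge_weighting E {1..int k} w \<and> edge_injective E w \<and>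
              neighbour_sum_distinguishing E w" for k
    proof -
      obtain w where "w ` E \<subseteq> {1..int k}" "inj_on w E"
        using ex by (auto simp: edge_weighting_def edge_injective_def)
      then have "card E \<le> card {1..int k}"
        by (intro card_inj_on_le) auto
      then show ?thesis
        by simp
    qed
  qed
  ultimately show ?thesis
    by blast
qed

end
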